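(* Let $G$ be a properly triangulated toroidal (PTT) graph that has a rectangular dual $\mathcal{R}$ on a flat torus $Q$, and let $\mathcal{L}$ be the corresponding toroidal REL (the one arising from $\mathcal{R}$). Then $\mathcal{L}$ is realizable. If moreover $Q$ is an (axis-aligned) rectangle, then $\mathcal{L}$ is orbital.
   Context: Graphs are finite and connected; loops and parallel edges are allowed. A flat torus is a parallelogram $Q$ with both pairs of opposite sides identified. Its sides give two closed curves crossing exactly once: the meridian $M$ (first orbit; not horizontal, directed upward) and the horizon $H$ (second orbit; not vertical, directed left-to-right). For closed directed curves $C,C'$ on the torus, the algebraic crossing number $\hat\imath(C,C')$ is the number of times $C$ crosses $C'$ left-to-right minus the number of times $C$ crosses $C'$ right-to-left. Put $m(C)=\hat\imath(C,M)$, $h(C)=\hat\imath(H,C)$; $(m(C),h(C))$ is the homotopy class of $C$. Thus $M$ has class $(0,1)$ and $H$ has class $(1,0)$. Two curves are parallel if they have the same homotopy class. A directed cycle of an embedded graph is treated as the closed directed curve it traces. PTT graph: a graph embedded without crossings on the torus in which every face is a triangle and all loops, parallel edges (the closed curve formed by two of them) and separating triangles (triangles that do not bound a face) are non-contractible. A toroidal rectangular dual of $G$ is a contact representation of $G$ on a flat torus $Q$: each vertex $v$ is mapped to a non-empty axis-aligned rectangle $\mathcal{R}(v)$ on $Q$ (which may extend across the identified sides), rectangles are interior-disjoint, the edges of $G$ correspond to the contacts (shared boundary segments) between rectangles (loops and parallel edges arise from contacts across the identified sides), such that (i) no four rectangles share a point and (ii) the union of the rectangles fills $Q$. The embedding of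 $G$ with respect to $M$ and $H$ is the one read off from $\mathcal{R}$ on $Q$ (vertices inside their rectangles, edges through their contacts). The REL $\mathcal{L}=(L_1,L_2)$ arising from $\mathcal{R}$: an edge $\{u,v\}$ is blue (in $L_1$) [red (in $L_2$)] and oriented $(u,v)$ if it is represented by a shared horizontal [vertical] segment with $\mathcal{R}(u)$ below [to the left of] $\mathcal{R}(v)$. $L_i(G)$ is the directed subgraph formed by the edges of $L_i$. $\mathcal{L}$ is realizable if, for both $i\in\{1,2\}$, every edge of $L_i(G)$ lies on a directed cycle of $L_i(G)$. A cycle is $i$-orbital if it is parallel to the $i$th orbit (class $(0,1)$ for $i=1$, $(1,0)$ for $i=2$). $\mathcal{L}$ is orbital if, for both $i\in\{1,2\}$, every edge of $L_i(G)$ lies on an $i$-orbital directed cycle of $L_i(G)$. *)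

theory Defs
  imports
    "HOL-Analysis.Analysis"
    "Graph_Theory.Digraph_Component"
begin

section \<open>Flat tori\<close>

text \<open>
  A flat torus is given by the side vectors of its parallelogram, one corner being placed at the
  origin of the coordinate system. Everything on the torus is described in the plane, its universal
  cover, up to translation by the lattice of integer combinations of the two side vectors.
  Positivity of the cross product is what gives the meridian the class \<open>(0, 1)\<close> and the
  horizon the class \<open>(1, 0)\<close>; see \<open>homotopy_class_meridian\<close> below.
\<close>

type_synonym plane = "real \<times> real"

record flat_torus =
  meridian :: plane
  horizon :: plane

definition cross :: "plane \<Rightarrow> plane \<Rightarrow> real" where
  "cross a b = fst a * snd b - snd a * fst b"

definition is_flat_torus :: "flat_torus \<Rightarrow> bool" where
  "is_flat_torus Q \<longleftrightarrow>
     snd (meridian Q) > 0 \<and> fst (horizon Q) > 0 \<and> cross (horizon Q) (meridian Q) > 0"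

definition axis_aligned :: "flat_torus \<Rightarrow> bool" where
  "axis_aligned Q \<longleftrightarrow> fst (meridian Q) = 0 \<and> snd (horizon Q) = 0"

definition lat :: "flat_torus \<Rightarrow> int \<times> int \<Rightarrow> plane" where
  "lat Q k = of_int (fst k) *\<^sub>R horizon Q + of_int (snd k) *\<^sub>R meridian Q"

definition translate :: "flat_torus \<Rightarrow> int \<times> int \<Rightarrow> plane set \<Rightarrow> plane set" where
  "translate Q k A = (\<lambda>z. lat Q k + z) ` A"


section \<open>Closed curves, crossing numbers, homotopy classes\<close>

text \<open>
  A closed directed curve on the torus is a sequence of polygonal pieces, each given by the points of
  a lift to the plane. The lifts of different pieces may be chosen independently of each other.

  \<open>left_of d c z\<close>: the point \<open>z\<close> lies strictly to the left of the line through
  \<open>c\<close> with direction \<open>d\<close>. The lifts of \<open>M\<close> are the lines with direction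
  \<open>meridian Q\<close> through the integer multiples of \<open>horizon Q\<close>, and vice versa
  for \<open>H\<close>. A segment crosses such a line at most once, so the crossings of each
  direction can be counted by the lines crossed; points on a line are counted as lying on its right.
\<close>

definition left_of :: "plane \<Rightarrow> plane \<Rightarrow> plane \<Rightarrow> bool" where
  "left_of d c z \<longleftrightarrow> cross d (z - c) > 0"

definition left_to_right :: "plane \<Rightarrow> plane \<Rightarrow> plane \<Rightarrow> plane \<Rightarrow> nat" where
  "left_to_right d t x y =
     card {k :: int. left_of d (of_int k *\<^sub>R t) x \<and> \<not> left_of d (of_int k *\<^sub>R t) y}"

definition right_to_left :: "plane \<Rightarrow> plane \<Rightarrow> plane \<Rightarrow> plane \<Rightarrow> nat" where
  "right_to_left d t x y =
     card {k :: int. \<not> left_of d (of_int k *\<^sub>R t) x \<and> left_of d (of_int k *\<^sub>R t) y}"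

fun crossings :: "plane \<Rightarrow> plane \<Rightarrow> plane list \<Rightarrow> int" where
  "crossings d t (x # y # P) =
     int (left_to_right d t x y) - int (right_to_left d t x y) + crossings d t (y # P)"
| "crossings d t P = 0"

type_synonym curve = "plane list list"

definition m_class :: "flat_torus \<Rightarrow> curve \<Rightarrow> int" where
  "m_class Q C = (\<Sum>P\<leftarrow>C. crossings (meridian Q) (horizon Q) P)"

text \<open>
  The second component counts the crossings of \<open>H\<close> over \<open>C\<close>: where \<open>C\<close>
  crosses \<open>H\<close> from right to left, \<open>H\<close> crosses \<open>C\<close> from left to right.
\<close>

definition h_class :: "flat_torus \<Rightarrow> curve \<Rightarrow> int" where
  "h_class Q C = - (\<Sum>P\<leftarrow>C. crossings (horizon Q) (meridian Q) P)"

definition homotopy_class :: "flat_torus \<Rightarrow> curve \<Rightarrow> int \<times> int" where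
  "homotopy_class Q C = (m_class Q C, h_class Q C)"

definition parallel :: "flat_torus \<Rightarrow> curve \<Rightarrow> curve \<Rightarrow> bool" where
  "parallel Q C C' \<longleftrightarrow> homotopy_class Q C = homotopy_class Q C'"

definition contractible_curve :: "flat_torus \<Rightarrow> curve \<Rightarrow> bool" where
  "contractible_curve Q C \<longleftrightarrow> homotopy_class Q C = (0, 0)"

definition first_orbit :: "flat_torus \<Rightarrow> curve" where
  "first_orbit Q = [[0, meridian Q]]"

definition second_orbit :: "flat_torus \<Rightarrow> curve" where
  "second_orbit Q = [[0, horizon Q]]"


section \<open>Embedded graphs\<close>

text \<open>
  A multigraph is a \<open>pre_digraph\<close> whose arcs are the undirected edges, each with an
  arbitrary reference direction that carries no meaning. A dart is an edge together with a direction
  of traversal, \<open>True\<close> being the reference direction.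
\<close>

type_synonym 'e dart = "'e \<times> bool"

definition dtail :: "('v, 'e) pre_digraph \<Rightarrow> 'e dart \<Rightarrow> 'v" where
  "dtail G d = (if snd d then tail G (fst d) else head G (fst d))"

definition dhead :: "('v, 'e) pre_digraph \<Rightarrow> 'e dart \<Rightarrow> 'v" where
  "dhead G d = (if snd d then head G (fst d) else tail G (fst d))"

definition darts :: "('v, 'e) pre_digraph \<Rightarrow> 'e dart set" where
  "darts G = arcs G \<times> UNIV"

definition dart_digraph :: "('v, 'e) pre_digraph \<Rightarrow> 'e dart set \<Rightarrow> ('v, 'e dart) pre_digraph" where
  "dart_digraph G L = \<lparr>verts = verts G, arcs = L, tail = dtail G, head = dhead G\<rparr>"

definition closed_walk :: "('v, 'e) pre_digraph \<Rightarrow> 'e dart list \<Rightarrow> bool" where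
  "closed_walk G ds \<longleftrightarrow> ds \<noteq> [] \<and> (\<exists>u. pre_digraph.awalk (dart_digraph G (darts G)) u ds u)"

text \<open>
  A drawing on the torus, lifted to the plane: \<open>pt v\<close> is a lift of the position of
  \<open>v\<close>, and \<open>route e\<close> lists the points of a lift of the polygonal arc of
  \<open>e\<close>, which leads from \<open>pt (tail G e)\<close> to the translate of
  \<open>pt (head G e)\<close> by the lattice vector \<open>shift e\<close>.
\<close>

record ('v, 'e) drawing =
  pt :: "'v \<Rightarrow> plane"
  route :: "'e \<Rightarrow> plane list"
  shift :: "'e \<Rightarrow> int \<times> int"

fun polyline :: "plane list \<Rightarrow> real \<Rightarrow> plane" where
  "polyline [] = linepath 0 0"
| "polyline [x] = linepath x x"
| "polyline [x, y] = linepath x y"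
| "polyline (x # y # z # P) = linepath x y +++ polyline (y # z # P)"

definition congruent_mod :: "flat_torus \<Rightarrow> plane \<Rightarrow> plane \<Rightarrow> bool" where
  "congruent_mod Q x y \<longleftrightarrow> (\<exists>k. y = lat Q k + x)"

definition embedded ::
  "flat_torus \<Rightarrow> ('v, 'e) pre_digraph \<Rightarrow> ('v, 'e) drawing \<Rightarrow> bool" where
  "embedded Q G D \<longleftrightarrow>
     (\<forall>u\<in>verts G. \<forall>v\<in>verts G. congruent_mod Q (pt D u) (pt D v) \<longrightarrow> u = v) \<and>
     (\<forall>e\<in>arcs G.
        length (route D e) \<ge> 2 \<and>
        hd (route D e) = pt D (tail G e) \<and>
        last (route D e) = lat Q (shift D e) + pt D (head G e)) \<and>
     (\<forall>e\<in>arcs G. \<forall>v\<in>verts G. \<forall>t\<in>{0..1}.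
        congruent_mod Q (polyline (route D e) t) (pt D v) \<longrightarrow> t \<in> {0, 1}) \<and>
     (\<forall>e\<in>arcs G. \<forall>f\<in>arcs G. \<forall>s\<in>{0..1}. \<forall>t\<in>{0..1}.
        congruent_mod Q (polyline (route D e) s) (polyline (route D f) t) \<longrightarrow>
          (e = f \<and> s = t) \<or> (s \<in> {0, 1} \<and> t \<in> {0, 1}))"

definition dshift :: "('v, 'e) drawing \<Rightarrow> 'e dart \<Rightarrow> int \<times> int" where
  "dshift D d = (if snd d then shift D (fst d) else - shift D (fst d))"

definition droute :: "('v, 'e) drawing \<Rightarrow> 'e dart \<Rightarrow> plane list" where
  "droute D d = (if snd d then route D (fst d) else rev (route D (fst d)))"

definition walk_curve :: "('v, 'e) drawing \<Rightarrow> 'e dart list \<Rightarrow> curve" where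
  "walk_curve D ds = map (droute D) ds"


section \<open>PTT graphs\<close>

text \<open>
  The faces are taken in the plane: these are the lifts of the faces on the torus.
\<close>

definition lifted_graph ::
  "flat_torus \<Rightarrow> ('v, 'e) pre_digraph \<Rightarrow> ('v, 'e) drawing \<Rightarrow> plane set" where
  "lifted_graph Q G D =
     (\<Union>k. translate Q k (pt D ` verts G \<union>
            (\<Union>e\<in>arcs G. path_image (polyline (route D e)))))"

definition lifted_faces ::
  "flat_torus \<Rightarrow> ('v, 'e) pre_digraph \<Rightarrow> ('v, 'e) drawing \<Rightarrow> plane set set" where
  "lifted_faces Q G D = components (UNIV - lifted_graph Q G D)"

text \<open>
  The point set of the lift of a walk that starts at the \<open>k\<close>-translate of the lifted
  position of its first vertex. In the lift of a reversed edge, the start of the reversed route has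
  to be moved back by the shift of the edge.
\<close>

fun lifted_walk ::
  "flat_torus \<Rightarrow> ('v, 'e) drawing \<Rightarrow> int \<times> int \<Rightarrow> 'e dart list \<Rightarrow> plane set" where
  "lifted_walk Q D k [] = {}"
| "lifted_walk Q D k (d # ds) =
     translate Q (if snd d then k else k + dshift D d) (path_image (polyline (route D (fst d)))) \<union>
     lifted_walk Q D (k + dshift D d) ds"

definition triangle :: "('v, 'e) pre_digraph \<Rightarrow> 'e dart list \<Rightarrow> bool" where
  "triangle G ds \<longleftrightarrow> closed_walk G ds \<and> length ds = 3 \<and> distinct (map fst ds)"

definition bounds ::
  "flat_torus \<Rightarrow> ('v, 'e) drawing \<Rightarrow> 'e dart list \<Rightarrow> plane set \<Rightarrow> bool" where
  "bounds Q D ds F \<longleftrightarrow>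
     contractible_curve Q (walk_curve D ds) \<and> (\<exists>k. F = inside (lifted_walk Q D k ds))"

definition PTT :: "flat_torus \<Rightarrow> ('v, 'e) pre_digraph \<Rightarrow> ('v, 'e) drawing \<Rightarrow> bool" where
  "PTT Q G D \<longleftrightarrow>
     fin_digraph G \<and> Digraph_Component.connected G \<and> embedded Q G D \<and>
     (\<forall>F\<in>lifted_faces Q G D. \<exists>ds. triangle G ds \<and> bounds Q D ds F) \<and>
     (\<forall>ds. closed_walk G ds \<and> length ds = 1 \<longrightarrow>
        \<not> contractible_curve Q (walk_curve D ds)) \<and>
     (\<forall>ds. closed_walk G ds \<and> length ds = 2 \<and> distinct (map fst ds) \<longrightarrow>
        \<not> contractible_curve Q (walk_curve D ds)) \<and>
     (\<forall>ds. triangle G ds \<and> (\<nexists>F. F \<in> lifted_faces Q G D \<and> bounds Q D ds F) \<longrightarrow>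
        \<not> contractible_curve Q (walk_curve D ds))"


section \<open>Rectangular duals\<close>

text \<open>
  \<open>R v\<close> is one lift of the rectangle of \<open>v\<close>; the others are its translates.
\<close>

definition axis_rectangle :: "plane set \<Rightarrow> bool" where
  "axis_rectangle A \<longleftrightarrow> (\<exists>a b c d. a < b \<and> c < d \<and> A = {a..b} \<times> {c..d})"

definition contact :: "plane set \<Rightarrow> plane set \<Rightarrow> bool" where
  "contact A B \<longleftrightarrow> (\<exists>x y. x \<noteq> y \<and> A \<inter> B = closed_segment x y)"

definition below :: "plane set \<Rightarrow> plane set \<Rightarrow> bool" where
  "below A B \<longleftrightarrow> (\<exists>a b c. a < b \<and> A \<inter> B = {a..b} \<times> {c} \<and>
     (\<forall>z\<in>A. snd z \<le> c) \<and> (\<forall>z\<in>B. c \<le> snd z))"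

definition left_neighbour :: "plane set \<Rightarrow> plane set \<Rightarrow> bool" where
  "left_neighbour A B \<longleftrightarrow> (\<exists>a b c. a < b \<and> A \<inter> B = {c} \<times> {a..b} \<and>
     (\<forall>z\<in>A. fst z \<le> c) \<and> (\<forall>z\<in>B. c \<le> fst z))"

text \<open>
  A contact of \<open>R u\<close> with the \<open>k\<close>-translate of \<open>R v\<close> is the same
  contact on the torus as that of \<open>R v\<close> with the \<open>- k\<close>-translate of
  \<open>R u\<close>, and these two descriptions correspond to the two darts of an edge. So the
  edges correspond one-to-one to the contacts if for each description there is exactly one dart.
\<close>

definition rectangular_dual ::
  "flat_torus \<Rightarrow> ('v, 'e) pre_digraph \<Rightarrow> ('v, 'e) drawing \<Rightarrow> ('v \<Rightarrow> plane set) \<Rightarrow> bool" where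
  "rectangular_dual Q G D R \<longleftrightarrow>
     (\<forall>v\<in>verts G. axis_rectangle (R v)) \<and>
     \<comment> \<open>interior-disjoint, including different lifts of the same rectangle\<close>
     (\<forall>u\<in>verts G. \<forall>v\<in>verts G. \<forall>k. (u, 0) \<noteq> (v, k) \<longrightarrow>
        interior (R u) \<inter> interior (translate Q k (R v)) = {}) \<and>
     \<comment> \<open>edges correspond to contacts\<close>
     (\<forall>d\<in>darts G. contact (R (dtail G d)) (translate Q (dshift D d) (R (dhead G d)))) \<and>
     (\<forall>u\<in>verts G. \<forall>v\<in>verts G. \<forall>k. contact (R u) (translate Q k (R v)) \<longrightarrow>
        (\<exists>!d. d \<in> darts G \<and> dtail G d = u \<and> dshift D d = k \<and> dhead G d = v)) \<and>
     \<comment> \<open>no four rectangles share a point\<close>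
     (\<nexists>z S. card S = 4 \<and> (\<forall>(v, k)\<in>S. v \<in> verts G \<and> z \<in> translate Q k (R v))) \<and>
     \<comment> \<open>the torus is filled\<close>
     (\<Union>v\<in>verts G. \<Union>k. translate Q k (R v)) = UNIV \<and>
     \<comment> \<open>the embedding is the one read off from the rectangles\<close>
     (\<forall>v\<in>verts G. pt D v \<in> interior (R v)) \<and>
     (\<forall>e\<in>arcs G.
        let A = R (tail G e); B = translate Q (shift D e) (R (head G e)) in
          path_image (polyline (route D e)) \<subseteq> interior A \<union> rel_interior (A \<inter> B) \<union> interior B)"


section \<open>Regular edge labelings\<close>

text \<open>
  A dart belongs to \<open>L\<^sub>1\<close> or \<open>L\<^sub>2\<close> if its edge has the respective colour
  and the dart is directed according to the orientation of the edge.
\<close>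

type_synonym 'e REL = "'e dart set \<times> 'e dart set"

definition REL_of ::
  "flat_torus \<Rightarrow> ('v, 'e) pre_digraph \<Rightarrow> ('v, 'e) drawing \<Rightarrow> ('v \<Rightarrow> plane set) \<Rightarrow> 'e REL" where
  "REL_of Q G D R =
     ({d \<in> darts G. below (R (dtail G d)) (translate Q (dshift D d) (R (dhead G d)))},
      {d \<in> darts G. left_neighbour (R (dtail G d)) (translate Q (dshift D d) (R (dhead G d)))})"

definition directed_cycle ::
  "('v, 'e) pre_digraph \<Rightarrow> 'e dart set \<Rightarrow> 'e dart list \<Rightarrow> bool" where
  "directed_cycle G L c \<longleftrightarrow> pre_digraph.cycle (dart_digraph G L) c"

definition realizable :: "('v, 'e) pre_digraph \<Rightarrow> 'e REL \<Rightarrow> bool" where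
  "realizable G \<L> \<longleftrightarrow>
     (\<forall>d\<in>fst \<L>. \<exists>c. directed_cycle G (fst \<L>) c \<and> d \<in> set c) \<and>
     (\<forall>d\<in>snd \<L>. \<exists>c. directed_cycle G (snd \<L>) c \<and> d \<in> set c)"

definition orbital ::
  "flat_torus \<Rightarrow> ('v, 'e) pre_digraph \<Rightarrow> ('v, 'e) drawing \<Rightarrow> 'e REL \<Rightarrow> bool" where
  "orbital Q G D \<L> \<longleftrightarrow>
     (\<forall>d\<in>fst \<L>. \<exists>c. directed_cycle G (fst \<L>) c \<and> d \<in> set c \<and>
        parallel Q (walk_curve D c) (first_orbit Q)) \<and>
     (\<forall>d\<in>snd \<L>. \<exists>c. directed_cycle G (snd \<L>) c \<and> d \<in> set c \<and>
        parallel Q (walk_curve D c) (second_orbit Q))"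


section \<open>Checks of the conventions\<close>

lemma homotopy_class_meridian:
  assumes "is_flat_torus Q"
  shows "homotopy_class Q (first_orbit Q) = (0, 1)"
proof -
  let ?p = "meridian Q" and ?q = "horizon Q"
  have pos: "cross ?q ?p > 0"
    using assms by (simp add: is_flat_torus_def)
  have M: "left_of ?p (of_int k *\<^sub>R ?q) 0 = left_of ?p (of_int k *\<^sub>R ?q) ?p" for k :: int
    by (simp add: left_of_def cross_def algebra_simps)
  have L0: "left_of ?q (of_int k *\<^sub>R ?p) 0 \<longleftrightarrow> k < 0" for k :: int
  proof -
    have "cross ?q (0 - of_int k *\<^sub>R ?p) = - (of_int k * cross ?q ?p)"
      by (simp add: cross_def algebra_simps)
    then show ?thesis
      using pos by (simp add: left_of_def mult_less_0_iff)
  qed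
  have L1: "left_of ?q (of_int k *\<^sub>R ?p) ?p \<longleftrightarrow> k < 1" for k :: int
  proof -
    have "cross ?q (?p - of_int k *\<^sub>R ?p) = (1 - of_int k) * cross ?q ?p"
      by (simp add: cross_def algebra_simps)
    then show ?thesis
      using pos by (simp add: left_of_def zero_less_mult_iff)
  qed
  have S: "{k::int. k < 0 \<and> \<not> k < 1} = {}" "{k::int. \<not> k < 0 \<and> k < 1} = {0}"
    by auto
  have "left_to_right ?q ?p 0 ?p = 0" "right_to_left ?q ?p 0 ?p = 1"
    unfolding left_to_right_def right_to_left_def L0 L1 S by simp_all
  moreover have "left_to_right ?p ?q 0 ?p = 0" "right_to_left ?p ?q 0 ?p = 0"
    by (simp_all add: left_to_right_def right_to_left_def M)
  ultimately show ?thesis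
    by (simp add: homotopy_class_def m_class_def h_class_def first_orbit_def)
qed

lemma homotopy_class_horizon:
  assumes "is_flat_torus Q"
  shows "homotopy_class Q (second_orbit Q) = (1, 0)"
proof -
  let ?p = "meridian Q" and ?q = "horizon Q"
  have pos: "cross ?q ?p > 0"
    using assms by (simp add: is_flat_torus_def)
  have H: "left_of ?q (of_int k *\<^sub>R ?p) 0 = left_of ?q (of_int k *\<^sub>R ?p) ?q" for k :: int
    by (simp add: left_of_def cross_def algebra_simps)
  have L0: "left_of ?p (of_int k *\<^sub>R ?q) 0 \<longleftrightarrow> k > 0" for k :: int
  proof -
    have "cross ?p (0 - of_int k *\<^sub>R ?q) = of_int k * cross ?q ?p"
      by (simp add: cross_def algebra_simps)
    then show ?thesis
      using pos by (simp add: left_of_def zero_less_mult_iff)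
  qed
  have L1: "left_of ?p (of_int k *\<^sub>R ?q) ?q \<longleftrightarrow> k > 1" for k :: int
  proof -
    have "cross ?p (?q - of_int k *\<^sub>R ?q) = (of_int k - 1) * cross ?q ?p"
      by (simp add: cross_def algebra_simps)
    then show ?thesis
      using pos by (simp add: left_of_def zero_less_mult_iff)
  qed
  have S: "{k::int. k > 0 \<and> \<not> k > 1} = {1}" "{k::int. \<not> k > 0 \<and> k > 1} = {}"
    by auto
  have "left_to_right ?p ?q 0 ?q = 1" "right_to_left ?p ?q 0 ?q = 0"
    unfolding left_to_right_def right_to_left_def L0 L1 S by simp_all
  moreover have "left_to_right ?q ?p 0 ?q = 0" "right_to_left ?q ?p 0 ?q = 0"
    by (simp_all add: left_to_right_def right_to_left_def H)
  ultimately show ?thesis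
    by (simp add: homotopy_class_def m_class_def h_class_def second_orbit_def)
qed

end

theory Submission
  imports Defs
begin

text \<open>
  The lengths of the contacts form a circulation on the blue graph: the contacts on the upper side
  of a rectangle cover it, and those on the lower side are disjoint, so both lengths sum to its
  width. A set of vertices closed under going up therefore has no arc entering it either, and
  applying this to the vertices reachable from the head of an arc closes the arc to a cycle.

  On an axis-aligned torus, a vertical line through the contact of an arc returns to this contact
  after one period, and the rectangles it meets on the way form a cycle parallel to the meridian.
  The class of a cycle is the sum of its shifts, as crossing numbers of polylines telescope.

  Exchanging the coordinates turns the red graph into the blue one.
\<close>


section \<open>Periodic tilings by rectangles\<close>

text \<open>\<open>\<Lambda>\<close> is kept abstract instead of being \<open>lat Q\<close>, so that
  the tiling with exchanged coordinates is again an instance. \<open>no_overlap_0\<close> expresses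
  disjointness of interiors, also for different translates of one rectangle.\<close>

locale tiling =
  fixes V :: "'v set"
    and X0 X1 Y0 Y1 :: "'v \<Rightarrow> real"
    and \<Lambda> :: "int \<times> int \<Rightarrow> plane"
  assumes finite_V: "finite V"
    and X_less: "v \<in> V \<Longrightarrow> X0 v < X1 v"
    and Y_less: "v \<in> V \<Longrightarrow> Y0 v < Y1 v"
    and shift_add: "\<Lambda> (j + k) = \<Lambda> j + \<Lambda> k"
    and locally_finite: "finite {k. \<bar>fst (\<Lambda> k)\<bar> \<le> B \<and> \<bar>snd (\<Lambda> k)\<bar> \<le> B}"
    and no_overlap_0: "\<lbrakk>u \<in> V; v \<in> V;
        max (X0 u) (X0 v + fst (\<Lambda> k)) < min (X1 u) (X1 v + fst (\<Lambda> k));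
        max (Y0 u) (Y0 v + snd (\<Lambda> k)) < min (Y1 u) (Y1 v + snd (\<Lambda> k))\<rbrakk> \<Longrightarrow> u = v \<and> k = 0"
    and cover: "\<exists>v\<in>V. \<exists>k. X0 v + fst (\<Lambda> k) \<le> x \<and> x \<le> X1 v + fst (\<Lambda> k) \<and>
        Y0 v + snd (\<Lambda> k) \<le> y \<and> y \<le> Y1 v + snd (\<Lambda> k)"
begin

section \<open>Lattice vectors and local finiteness\<close>

lemma shift_0: "\<Lambda> 0 = 0"
  using shift_add[of 0 0] by simp

lemma shift_diff: "\<Lambda> (j - k) = \<Lambda> j - \<Lambda> k"
  using shift_add[of "j - k" k] by simp

lemma no_overlap:
  assumes "u \<in> V" "v \<in> V"
    and "max (X0 u + fst (\<Lambda> j)) (X0 v + fst (\<Lambda> k)) < min (X1 u + fst (\<Lambda> j)) (X1 v + fst (\<Lambda> k))"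
    and "max (Y0 u + snd (\<Lambda> j)) (Y0 v + snd (\<Lambda> k)) < min (Y1 u + snd (\<Lambda> j)) (Y1 v + snd (\<Lambda> k))"
  shows "u = v \<and> j = k"
  using no_overlap_0[of u v "k - j"] assms by (auto simp: shift_diff)

lemma sides_bounded:
  obtains M where "\<And>v. v \<in> V \<Longrightarrow> \<bar>X0 v\<bar> + \<bar>X1 v\<bar> + \<bar>Y0 v\<bar> + \<bar>Y1 v\<bar> \<le> M"
proof -
  let ?M = "\<lambda>v. \<bar>X0 v\<bar> + \<bar>X1 v\<bar> + \<bar>Y0 v\<bar> + \<bar>Y1 v\<bar>"
  have "?M v \<le> sum ?M V" if "v \<in> V" for v
    using finite_V that by (intro member_le_sum) auto
  then show thesis
    by (rule that)
qed

text \<open>The sides are bounded uniformly over the finite set \<open>V\<close>, so a translate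
  meeting the square has a bounded lattice vector, and \<open>locally_finite\<close>
  applies.\<close>

lemma finite_meeting_box:
  "finite {(v, k). v \<in> V \<and> - B \<le> X1 v + fst (\<Lambda> k) \<and> X0 v + fst (\<Lambda> k) \<le> B \<and>
      - B \<le> Y1 v + snd (\<Lambda> k) \<and> Y0 v + snd (\<Lambda> k) \<le> B}" (is "finite ?A")
proof -
  obtain M where M: "\<And>v. v \<in> V \<Longrightarrow> \<bar>X0 v\<bar> + \<bar>X1 v\<bar> + \<bar>Y0 v\<bar> + \<bar>Y1 v\<bar> \<le> M"
    using sides_bounded by blast
  let ?K = "{k. \<bar>fst (\<Lambda> k)\<bar> \<le> B + M \<and> \<bar>snd (\<Lambda> k)\<bar> \<le> B + M}"
  have "?A \<subseteq> V \<times> ?K"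
    using M by fastforce
  then show ?thesis
    using finite_V locally_finite finite_subset by blast
qed

section \<open>Horizontal contacts and the balance of their lengths\<close>

definition above :: "'v \<Rightarrow> 'v \<Rightarrow> int \<times> int \<Rightarrow> bool" where
  "above u v k \<longleftrightarrow> Y0 v + snd (\<Lambda> k) = Y1 u \<and>
     max (X0 u) (X0 v + fst (\<Lambda> k)) < min (X1 u) (X1 v + fst (\<Lambda> k))"

text \<open>The length of the contact if \<open>above u v k\<close> holds; it acts as the flow along
  the contact.\<close>

definition overlap :: "'v \<Rightarrow> 'v \<Rightarrow> int \<times> int \<Rightarrow> real" where
  "overlap u v k = min (X1 u) (X1 v + fst (\<Lambda> k)) - max (X0 u) (X0 v + fst (\<Lambda> k))"

text \<open>A rectangle resting on \<open>u\<close> meets the fixed square that contains all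
  untranslated rectangles. This keeps the later sums over contacts finite.\<close>

lemma finite_above: "finite {(u, v, k). u \<in> V \<and> v \<in> V \<and> above u v k}"
proof -
  obtain M where M: "\<And>v. v \<in> V \<Longrightarrow> \<bar>X0 v\<bar> + \<bar>X1 v\<bar> + \<bar>Y0 v\<bar> + \<bar>Y1 v\<bar> \<le> M"
    using sides_bounded by blast
  let ?A = "{(v, k). v \<in> V \<and> - M \<le> X1 v + fst (\<Lambda> k) \<and> X0 v + fst (\<Lambda> k) \<le> M \<and>
      - M \<le> Y1 v + snd (\<Lambda> k) \<and> Y0 v + snd (\<Lambda> k) \<le> M}"
  have "{(u, v, k). u \<in> V \<and> v \<in> V \<and> above u v k} \<subseteq> V \<times> ?A"
  proof
    fix t assume "t \<in> {(u, v, k). u \<in> V \<and> v \<in> V \<and> above u v k}"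
    then obtain u v k where t: "t = (u, v, k)" "u \<in> V" "v \<in> V" "above u v k"
      by auto
    then have "(v, k) \<in> ?A"
      using M[of u] Y_less[of v] by (auto simp: above_def)
    with t show "t \<in> V \<times> ?A"
      by simp
  qed
  then show ?thesis
    by (rule finite_subset) (intro finite_cartesian_product finite_V finite_meeting_box)
qed

text \<open>Near \<open>x\<close>, a thin strip just above the top of \<open>u\<close> contains no
  bottom sides. The rectangle covering a point of this strip at abscissa \<open>x\<close> therefore
  starts at or below \<open>Y1 u\<close>, and starting lower would make it overlap
  \<open>u\<close>.\<close>

lemma exists_above:
  assumes u: "u \<in> V" and x: "X0 u < x" "x < X1 u"
  obtains v k where "v \<in> V" "above u v k" "X0 v + fst (\<Lambda> k) \<le> x" "x \<le> X1 v + fst (\<Lambda> k)"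
proof -
  \<comment> \<open>Large enough for \<open>?F\<close> to list every rectangle covering a point
    \<open>(x, y)\<close> with \<open>y\<close> between \<open>Y1 u\<close> and
    \<open>Y1 u + 1\<close>.\<close>
  define B where "B = \<bar>x\<bar> + \<bar>Y1 u\<bar> + 1"
  let ?F = "{(v, k). v \<in> V \<and> - B \<le> X1 v + fst (\<Lambda> k) \<and> X0 v + fst (\<Lambda> k) \<le> B \<and>
      - B \<le> Y1 v + snd (\<Lambda> k) \<and> Y0 v + snd (\<Lambda> k) \<le> B}"
  define bs where "bs = {y. y > Y1 u \<and> y \<in> (\<lambda>(v, k). Y0 v + snd (\<Lambda> k)) ` ?F}"
  have "finite bs"
    unfolding bs_def using finite_meeting_box[of B] by auto
  \<comment> \<open>The value \<open>Y1 u + 1\<close> covers the case of empty \<open>bs\<close> and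
    keeps the chosen height in the range for which \<open>B\<close> was chosen.\<close>
  define m where "m = Min (insert (Y1 u + 1) bs)"
  have m: "m > Y1 u" "m \<le> Y1 u + 1" and m_le: "\<And>y. y \<in> bs \<Longrightarrow> m \<le> y"
    unfolding m_def using \<open>finite bs\<close> by (auto simp: bs_def)
  define y where "y = (Y1 u + m) / 2"
  have y: "Y1 u < y" "y < m"
    using m by (auto simp: y_def)
  obtain v k where v: "v \<in> V" and vk: "X0 v + fst (\<Lambda> k) \<le> x" "x \<le> X1 v + fst (\<Lambda> k)"
      "Y0 v + snd (\<Lambda> k) \<le> y" "y \<le> Y1 v + snd (\<Lambda> k)"
    using cover by blast
  have "(v, k) \<in> ?F"
    using v vk y m by (auto simp: B_def)
  then have "Y0 v + snd (\<Lambda> k) \<notin> bs"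
    using m_le[of "Y0 v + snd (\<Lambda> k)"] vk y by auto
  then have le: "Y0 v + snd (\<Lambda> k) \<le> Y1 u"
    using \<open>(v, k) \<in> ?F\<close> unfolding bs_def by force
  have X: "max (X0 u) (X0 v + fst (\<Lambda> k)) < min (X1 u) (X1 v + fst (\<Lambda> k))"
    using x vk X_less[OF u] X_less[OF v] by auto
  have "Y0 v + snd (\<Lambda> k) = Y1 u"
  proof (rule ccontr)
    assume "\<not> ?thesis"
    then have "max (Y0 u) (Y0 v + snd (\<Lambda> k)) < min (Y1 u) (Y1 v + snd (\<Lambda> k))"
      using le vk y Y_less[OF u] Y_less[OF v] by auto
    then have "u = v" "k = 0"
      using no_overlap_0[OF u v X] by auto
    then show False
      using vk y by (simp add: shift_0)
  qed
  with X v vk show thesis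
    by (auto simp: above_def intro: that)
qed

text \<open>Subadditivity of length: by \<open>exists_above\<close>, the contact segments on the
  upper side cover it up to its end points.\<close>

lemma width_le_sum_above:
  assumes u: "u \<in> V"
  shows "X1 u - X0 u \<le> (\<Sum>(v, k) \<in> {(v, k). v \<in> V \<and> above u v k}. overlap u v k)"
proof -
  let ?S = "{(v, k). v \<in> V \<and> above u v k}"
  let ?I = "\<lambda>(v, k). {max (X0 u) (X0 v + fst (\<Lambda> k)) .. min (X1 u) (X1 v + fst (\<Lambda> k))}"
  have fin: "finite ?S"
    by (rule finite_subset[OF _ finite_imageI[OF finite_above, of snd]]) (use u in force)
  have sub: "{X0 u<..<X1 u} \<subseteq> \<Union> (?I ` ?S)"
  proof
    fix x assume "x \<in> {X0 u<..<X1 u}"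
    then obtain v k where "v \<in> V" "above u v k" "X0 v + fst (\<Lambda> k) \<le> x" "x \<le> X1 v + fst (\<Lambda> k)"
      using exists_above[OF u, of x] by auto
    with \<open>x \<in> _\<close> show "x \<in> \<Union> (?I ` ?S)"
      by (intro UN_I[of "(v, k)"]) auto
  qed
  have Icc: "{a..b} \<in> fmeasurable lborel" for a b :: real
    by (intro fmeasurableI emeasure_compact_finite) auto
  have "X1 u - X0 u = measure lborel {X0 u<..<X1 u}"
    using X_less[OF u] by simp
  also have "\<dots> \<le> measure lborel (\<Union> (?I ` ?S))"
    using Icc by (intro measure_mono_fmeasurable[OF sub] fmeasurable.finite_UN fin) auto
  also have "\<dots> \<le> (\<Sum>i\<in>?S. measure lborel (?I i))"
    by (rule measure_UNION_le[OF fin]) auto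
  also have "\<dots> = (\<Sum>(v, k)\<in>?S. overlap u v k)"
    by (rule sum.cong) (auto simp: above_def overlap_def)
  finally show ?thesis .
qed

text \<open>Two contact segments with a common inner point would belong to rectangles of equal top
  height and overlapping widths. The intervals are open because neighbouring segments may share an
  end point.\<close>

lemma sum_below_le_width:
  assumes v: "v \<in> V"
  shows "(\<Sum>(u, k) \<in> {(u, k). u \<in> V \<and> above u v k}. overlap u v k) \<le> X1 v - X0 v"
proof -
  let ?S = "{(u, k). u \<in> V \<and> above u v k}"
  let ?I = "\<lambda>(u, k). {max (X0 u - fst (\<Lambda> k)) (X0 v) <..< min (X1 u - fst (\<Lambda> k)) (X1 v)}"
  have fin: "finite ?S"
    by (rule finite_subset[OF _ finite_imageI[OF finite_above, of "\<lambda>(u, v, k). (u, k)"]])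
      (use v in force)
  have dis: "pairwise (\<lambda>i j. disjnt (?I i) (?I j)) ?S"
  proof (intro pairwiseI)
    fix i j assume "i \<in> ?S" "j \<in> ?S" "i \<noteq> j"
    obtain u k w l where i: "i = (u, k)" and j: "j = (w, l)"
      by (metis surj_pair)
    have u: "u \<in> V" "above u v k" and w: "w \<in> V" "above w v l"
      using \<open>i \<in> _\<close> \<open>j \<in> _\<close> i j by auto
    show "disjnt (?I i) (?I j)"
    proof (rule ccontr)
      assume "\<not> ?thesis"
      then obtain x where x: "x \<in> ?I i" "x \<in> ?I j"
        by (auto simp: disjnt_def)
      \<comment> \<open>In \<open>above u v k\<close> the upper rectangle is the translated one;
        with \<open>v\<close> held fixed, the lower ones are the translates by \<open>- k\<close>
        and \<open>- l\<close>.\<close>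
      have "u = w \<and> - k = - l"
      proof (rule no_overlap)
        have neg: "\<Lambda> (- k) = - \<Lambda> k" "\<Lambda> (- l) = - \<Lambda> l"
          using shift_diff[of 0] by (auto simp: shift_0)
        show "max (X0 u + fst (\<Lambda> (- k))) (X0 w + fst (\<Lambda> (- l))) <
            min (X1 u + fst (\<Lambda> (- k))) (X1 w + fst (\<Lambda> (- l)))"
          using x by (auto simp: i j neg)
        show "max (Y0 u + snd (\<Lambda> (- k))) (Y0 w + snd (\<Lambda> (- l))) <
            min (Y1 u + snd (\<Lambda> (- k))) (Y1 w + snd (\<Lambda> (- l)))"
          using u w Y_less[of u] Y_less[of w] by (auto simp: above_def neg)
      qed (use u w in auto)
      with \<open>i \<noteq> j\<close> show False
        by (simp add: i j)
    qed
  qed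
  have Ioo: "{a<..<b} \<in> fmeasurable lborel" for a b :: real
    by (intro fmeasurableI emeasure_bounded_finite) auto
  have "(\<Sum>(u, k)\<in>?S. overlap u v k) = (\<Sum>i\<in>?S. measure lborel (?I i))"
    by (rule sum.cong) (auto simp: above_def overlap_def min_def max_def)
  also have "\<dots> = measure lborel (\<Union> (?I ` ?S))"
    using Ioo by (intro measure_UNION'[OF fin _ dis, symmetric]) auto
  also have "\<dots> \<le> measure lborel {X0 v<..<X1 v}"
    using Ioo by (intro measure_mono_fmeasurable sets.finite_UN fin) auto
  also have "\<dots> = X1 v - X0 v"
    using X_less[OF v] by simp
  finally show ?thesis .
qed

text \<open>
  Summed over \<open>S\<close>, the widths are at most the total overlap along the arcs leaving vertices of
  \<open>S\<close> and at least that along the arcs entering vertices of \<open>S\<close>.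
\<close>

lemma closed_above_imp_closed_below:
  assumes S: "S \<subseteq> V" and closed: "\<And>u v k. \<lbrakk>u \<in> S; v \<in> V; above u v k\<rbrakk> \<Longrightarrow> v \<in> S"
    and u: "u \<in> V" and v: "v \<in> S" and uv: "above u v k"
  shows "u \<in> S"
proof (rule ccontr)
  assume "u \<notin> S"
  let ?out = "\<lambda>u. {(v, k). v \<in> V \<and> above u v k}"
  let ?in = "\<lambda>v. {(u, k). u \<in> V \<and> above u v k}"
  let ?w = "\<lambda>(u, v, k). overlap u v k"
  let ?T = "{(u, v, k). u \<in> S \<and> v \<in> V \<and> above u v k}"
  let ?T' = "{(u, v, k). u \<in> V \<and> v \<in> S \<and> above u v k}"
  have finS: "finite S"
    using S finite_V finite_subset by blast
  have fin: "finite ?T" "finite ?T'"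
    by (rule finite_subset[OF _ finite_above]; use S in auto)+
  have fin_out: "finite (?out u)" if "u \<in> S" for u
    by (rule finite_subset[OF _ finite_imageI[OF finite_above, of snd]]) (use S that in force)
  have fin_in: "finite (?in v)" if "v \<in> S" for v
    by (rule finite_subset[OF _ finite_imageI[OF finite_above, of "\<lambda>(u, v, k). (u, k)"]])
      (use S that in force)
  have "(\<Sum>u\<in>S. X1 u - X0 u) \<le> (\<Sum>u\<in>S. \<Sum>(v, k)\<in>?out u. overlap u v k)"
    using S by (intro sum_mono width_le_sum_above) auto
  also have "\<dots> = (\<Sum>(u, v, k)\<in>Sigma S ?out. overlap u v k)"
    using finS fin_out by (subst sum.Sigma) (auto simp: case_prod_unfold)
  also have "Sigma S ?out = ?T"
    by auto
  \<comment> \<open>Closure gives \<open>?T \<subseteq> ?T'\<close>; the arc from \<open>u\<close>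
    outside \<open>S\<close> to \<open>v\<close> lies in \<open>?T'\<close> only, and its overlap is
    positive.\<close>
  also have "sum ?w ?T < sum ?w ?T'"
  proof (rule sum_strict_mono2)
    show "?T \<subseteq> ?T'"
      using S closed by blast
    show "(u, v, k) \<in> ?T' - ?T"
      using u v uv \<open>u \<notin> S\<close> by auto
  qed (use fin uv in \<open>auto simp: above_def overlap_def\<close>)
  also have "sum ?w ?T' = (\<Sum>(v, u, k)\<in>Sigma S ?in. overlap u v k)"
    by (rule sum.reindex_bij_witness[of _ "\<lambda>(v, u, k). (u, v, k)" "\<lambda>(u, v, k). (v, u, k)"]) auto
  also have "\<dots> = (\<Sum>v\<in>S. \<Sum>(u, k)\<in>?in v. overlap u v k)"
    using finS fin_in by (subst sum.Sigma) (auto simp: case_prod_unfold)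
  also have "\<dots> \<le> (\<Sum>v\<in>S. X1 v - X0 v)"
    using S by (intro sum_mono sum_below_le_width) auto
  finally show False
    by simp
qed

end

section \<open>Cycles through a given contact\<close>

locale tiling_digraph = wf_digraph H + tiling "verts H" X0 X1 Y0 Y1 \<Lambda>
  for H :: "('v, 'd) pre_digraph" (structure)
    and X0 X1 Y0 Y1 :: "'v \<Rightarrow> real" and \<Lambda> :: "int \<times> int \<Rightarrow> plane" +
  fixes sh :: "'d \<Rightarrow> int \<times> int"
  assumes arc_above: "e \<in> arcs H \<Longrightarrow> above (tail H e) (head H e) (sh e)"
    and above_arc: "\<lbrakk>u \<in> verts H; v \<in> verts H; above u v k\<rbrakk> \<Longrightarrow>
        \<exists>e\<in>arcs H. tail H e = u \<and> head H e = v \<and> sh e = k"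
begin

lemma arc_in_cycle:
  assumes e: "e \<in> arcs H"
  obtains c where "cycle c" "e \<in> set c"
proof -
  let ?v = "head H e"
  let ?S = "{w. \<exists>p. awalk ?v p w}"
  \<comment> \<open>The empty walk puts \<open>?v\<close> into \<open>?S\<close>, so
    \<open>e\<close> is an arc entering \<open>?S\<close>.\<close>
  have "tail H e \<in> ?S"
  proof (rule closed_above_imp_closed_below)
    show "?S \<subseteq> verts H"
      by auto
    show "above (tail H e) ?v (sh e)"
      using e by (rule arc_above)
    show "?v \<in> ?S"
      using e by (auto intro!: exI[of _ "[]"] simp: awalk_Nil_iff)
  next
    fix u v k assume "u \<in> ?S" "v \<in> verts H" "above u v k"
    then obtain p where p: "awalk ?v p u"
      by blast
    then obtain f where f: "f \<in> arcs H" "tail H f = u" "head H f = v"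
      using above_arc[OF awalk_last_in_verts[OF p] \<open>v \<in> verts H\<close> \<open>above u v k\<close>] by blast
    with \<open>v \<in> verts H\<close> have "awalk u [f] v"
      by (simp add: awalk_simps)
    with p have "awalk ?v (p @ [f]) v"
      by (rule awalk_appendI)
    then show "v \<in> ?S"
      by blast
  qed (use e in auto)
  \<comment> \<open>A path instead of a walk ensures that the closed-up cycle repeats no
    vertex.\<close>
  then obtain p where "apath ?v p (tail H e)"
    using apath_awalk_to_apath by blast
  then have "cycle (e # p)"
    using e by (auto simp: cycle_def apath_def awalk_Cons_iff)
  then show thesis
    by (intro that) auto
qed

text \<open>
  A line through the arc that avoids the sides of all rectangles and runs once around the torus
  meets every rectangle of the torus at most once, so the rectangles on it form a simple cycle.
\<close>

lemma arc_in_orbital_cycle: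
  assumes e: "e \<in> arcs H"
    and W: "W > 0" "\<Lambda> q = (W, 0)" and H: "h > 0" "\<Lambda> p = (0, h)"
    and per: "\<And>k. \<exists>i j :: int. \<Lambda> k = (of_int i * W, of_int j * h)"
  obtains c where "cycle c" "e \<in> set c" "sum_list (map sh c) = p"
proof -
  let ?u = "tail H e" and ?v = "head H e"
  \<comment> \<open>The abscissae of all vertical sides of all translates. They are countably many,
    so the line at \<open>x\<close> can avoid them.\<close>
  define U where "U = (\<Union>v\<in>verts H. \<Union>k. {X0 v + fst (\<Lambda> k), X1 v + fst (\<Lambda> k)})"
  have "countable U"
    unfolding U_def using finite_V by (intro countable_UN countableI_type) (auto intro: countable_finite)
  have uv: "above ?u ?v (sh e)"
    using e by (rule arc_above)
  obtain x where x: "max (X0 ?u) (X0 ?v + fst (\<Lambda> (sh e))) < x"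
      "x < min (X1 ?u) (X1 ?v + fst (\<Lambda> (sh e)))" and "x \<notin> U"
  proof -
    have "uncountable {max (X0 ?u) (X0 ?v + fst (\<Lambda> (sh e))) <..<
        min (X1 ?u) (X1 ?v + fst (\<Lambda> (sh e)))}"
      using uv by (simp add: above_def uncountable_open_interval del: max_less_iff_conj min_less_iff_conj)
    then have "\<not> {max (X0 ?u) (X0 ?v + fst (\<Lambda> (sh e))) <..<
        min (X1 ?u) (X1 ?v + fst (\<Lambda> (sh e)))} \<subseteq> U"
      using \<open>countable U\<close> countable_subset by blast
    then obtain x where "x \<in> {max (X0 ?u) (X0 ?v + fst (\<Lambda> (sh e))) <..<
        min (X1 ?u) (X1 ?v + fst (\<Lambda> (sh e)))}" "x \<notin> U"
      by blast
    then show thesis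
      using that[of x] by simp
  qed
  \<comment> \<open>The translates crossed by the line at \<open>x\<close> within one period,
    counted from the top of the tail. The upper bound is the top of the tail's translate by
    \<open>p\<close>, where the walk is to end.\<close>
  define good where "good w l \<longleftrightarrow> w \<in> verts H \<and>
      X0 w + fst (\<Lambda> l) < x \<and> x < X1 w + fst (\<Lambda> l) \<and>
      Y1 ?u \<le> Y0 w + snd (\<Lambda> l) \<and> Y1 w + snd (\<Lambda> l) \<le> Y1 ?u + h" for w l
  have fin: "finite {(w, l). good w l}"
  proof -
    define B where "B = \<bar>x\<bar> + \<bar>Y1 ?u\<bar> + h"
    show ?thesis
    proof (rule finite_subset[OF _ finite_meeting_box[of B]], clarify)
      fix w a b assume "good w (a, b)"
      then show "w \<in> verts H \<and> - B \<le> X1 w + fst (\<Lambda> (a, b)) \<and> X0 w + fst (\<Lambda> (a, b)) \<le> B \<and>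
          - B \<le> Y1 w + snd (\<Lambda> (a, b)) \<and> Y0 w + snd (\<Lambda> (a, b)) \<le> B"
        using Y_less[of w] H by (auto simp: good_def B_def)
    qed
  qed
  \<comment> \<open>Two such translates of \<open>w\<close> differ by multiples of \<open>W\<close>
    and \<open>h\<close>. Both contain \<open>x\<close> in their width, which is at most
    \<open>W\<close> by disjointness from the translate by \<open>q\<close>, and both fit into a
    height of \<open>h\<close>, so the multiples vanish.\<close>
  have unique: "l = m" if l: "good w l" and m: "good w m" for w l m
  proof -
    have w: "w \<in> verts H"
      using l by (simp add: good_def)
    obtain i j :: int where ij: "\<Lambda> (m - l) = (of_int i * W, of_int j * h)"
      using per by blast
    have width: "X1 w - X0 w \<le> W"
    proof (rule ccontr)
      assume "\<not> ?thesis"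
      then have "0 = q"
        using no_overlap_0[OF w w, of q] W Y_less[OF w] by auto
      then show False
        using W shift_0 by (auto simp: zero_prod_def)
    qed
    have "\<bar>of_int i * W\<bar> < W" "\<bar>of_int j * h\<bar> < h"
      using ij l m width Y_less[OF w] by (auto simp: shift_diff good_def prod_eq_iff)
    then have "i = 0" "j = 0"
      using W H by (auto simp: abs_mult)
    then have "\<Lambda> m = \<Lambda> l"
      using ij shift_diff[of m l] by (simp flip: zero_prod_def)
    \<comment> \<open>Equal lattice vectors force equal indices, since otherwise \<open>w\<close>
      would overlap a different translate of itself.\<close>
    then show "l = m"
      using no_overlap[OF w w, of l m] X_less[OF w] Y_less[OF w] by auto
  qed
  \<comment> \<open>The walk climbs from the \<open>l\<close>-translate of \<open>w\<close> to the
    \<open>p\<close>-translate of the tail, hence the sum \<open>p - l\<close>. The height bound on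
    its vertices is carried along to exclude a return to an earlier vertex.\<close>
  have *: "\<exists>ds. awalk w ds ?u \<and> distinct (awalk_verts w ds) \<and> sum_list (map sh ds) = p - l \<and>
      (\<forall>z\<in>set (awalk_verts w ds). \<exists>m. good z m \<and> Y0 w + snd (\<Lambda> l) \<le> Y0 z + snd (\<Lambda> m))"
    if "good w l" for w l
    using that
  proof (induction "card {(z, m). good z m \<and> Y0 w + snd (\<Lambda> l) \<le> Y0 z + snd (\<Lambda> m)}"
      arbitrary: w l rule: less_induct)
    case less
    note good = less.prems
    have w: "w \<in> verts H"
      using good by (simp add: good_def)
    have u: "?u \<in> verts H"
      using e by simp
    show ?case
    proof (cases "Y1 w + snd (\<Lambda> l) = Y1 ?u + h")
      case True
      \<comment> \<open>Both rectangles have the same top and contain \<open>x\<close> in their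
        widths, so they overlap and coincide.\<close>
      have "w = ?u \<and> l = p"
      proof (rule no_overlap[OF w u])
        show "max (X0 w + fst (\<Lambda> l)) (X0 ?u + fst (\<Lambda> p)) <
            min (X1 w + fst (\<Lambda> l)) (X1 ?u + fst (\<Lambda> p))"
          using good x H by (auto simp: good_def)
        show "max (Y0 w + snd (\<Lambda> l)) (Y0 ?u + snd (\<Lambda> p)) <
            min (Y1 w + snd (\<Lambda> l)) (Y1 ?u + snd (\<Lambda> p))"
          using True H Y_less[OF w] Y_less[OF u] by auto
      qed
      then show ?thesis
        using good u by (intro exI[of _ "[]"]) (auto simp: awalk_Nil_iff simp del: split_paired_Ex)
    next
      case False
      then have lt: "Y1 w + snd (\<Lambda> l) < Y1 ?u + h"
        using good by (simp add: good_def)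
      obtain v k where v: "v \<in> verts H" "above w v k"
          "X0 v + fst (\<Lambda> k) \<le> x - fst (\<Lambda> l)" "x - fst (\<Lambda> l) \<le> X1 v + fst (\<Lambda> k)"
        using exists_above[OF w, of "x - fst (\<Lambda> l)"] good by (auto simp: good_def)
      let ?m = "l + k"
      \<comment> \<open>The choice of \<open>x\<close> outside \<open>U\<close> makes the weak
        inequalities of \<open>exists_above\<close> strict.\<close>
      have "x \<noteq> X0 v + fst (\<Lambda> ?m)" "x \<noteq> X1 v + fst (\<Lambda> ?m)"
        using \<open>x \<notin> U\<close> v(1) unfolding U_def by blast+
      then have xv: "X0 v + fst (\<Lambda> ?m) < x" "x < X1 v + fst (\<Lambda> ?m)"
        using v by (auto simp: shift_add)
      have bot: "Y0 v + snd (\<Lambda> ?m) = Y1 w + snd (\<Lambda> l)"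
        using v by (auto simp: above_def shift_add)
      \<comment> \<open>The climb cannot skip its target: a rectangle starting below
        \<open>Y1 ?u + h\<close> and ending above it would overlap the \<open>p\<close>-translate of
        the tail and so equal it, but that one ends exactly at this height.\<close>
      have "Y1 v + snd (\<Lambda> ?m) \<le> Y1 ?u + h"
      proof (rule ccontr)
        assume top: "\<not> ?thesis"
        have "v = ?u \<and> ?m = p"
        proof (rule no_overlap[OF v(1) u])
          show "max (X0 v + fst (\<Lambda> ?m)) (X0 ?u + fst (\<Lambda> p)) <
              min (X1 v + fst (\<Lambda> ?m)) (X1 ?u + fst (\<Lambda> p))"
            using xv x H by auto
          show "max (Y0 v + snd (\<Lambda> ?m)) (Y0 ?u + snd (\<Lambda> p)) <
              min (Y1 v + snd (\<Lambda> ?m)) (Y1 ?u + snd (\<Lambda> p))"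
            using top bot lt H Y_less[OF v(1)] Y_less[OF u] by auto
        qed
        then show False
          using top H by auto
      qed
      then have good': "good v ?m"
        using good bot xv v(1) Y_less[OF w] by (auto simp: good_def)
      have up: "Y0 w + snd (\<Lambda> l) < Y0 v + snd (\<Lambda> ?m)"
        using bot Y_less[OF w] by simp
      have "card {(z, m). good z m \<and> Y0 v + snd (\<Lambda> ?m) \<le> Y0 z + snd (\<Lambda> m)} <
          card {(z, m). good z m \<and> Y0 w + snd (\<Lambda> l) \<le> Y0 z + snd (\<Lambda> m)}"
      proof (rule psubset_card_mono)
        let ?A = "{(z, m). good z m \<and> Y0 w + snd (\<Lambda> l) \<le> Y0 z + snd (\<Lambda> m)}"
        let ?A' = "{(z, m). good z m \<and> Y0 v + snd (\<Lambda> ?m) \<le> Y0 z + snd (\<Lambda> m)}"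
        show "finite ?A"
          by (rule finite_subset[OF _ fin]) auto
        have "?A' \<subseteq> ?A"
          using up by auto
        moreover have "(w, l) \<in> ?A" "(w, l) \<notin> ?A'"
          using good up by simp_all
        then have "?A' \<noteq> ?A"
          by metis
        ultimately show "?A' \<subset> ?A"
          by (rule psubsetI)
      qed
      from less.hyps[OF this good'] obtain ds where ds: "awalk v ds ?u"
          "distinct (awalk_verts v ds)" "sum_list (map sh ds) = p - ?m"
          and hgt: "\<And>z. z \<in> set (awalk_verts v ds) \<Longrightarrow>
            \<exists>m. good z m \<and> Y0 v + snd (\<Lambda> ?m) \<le> Y0 z + snd (\<Lambda> m)"
        by blast
      obtain f where f: "f \<in> arcs H" "tail H f = w" "head H f = v" "sh f = k"
        using above_arc[OF w v(1,2)] by blast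
      \<comment> \<open>By \<open>unique\<close>, the only good translate of \<open>w\<close> is the
        one by \<open>l\<close>, which starts too low for the rest of the walk.\<close>
      have "w \<notin> set (awalk_verts v ds)"
      proof
        assume "w \<in> set (awalk_verts v ds)"
        then obtain m where "good w m" "Y0 v + snd (\<Lambda> ?m) \<le> Y0 w + snd (\<Lambda> m)"
          using hgt by blast
        then show False
          using unique[OF good, of m] up by simp
      qed
      then have "distinct (awalk_verts w (f # ds))"
        using ds f by simp
      moreover have "awalk w (f # ds) ?u"
        using ds f by (simp add: awalk_Cons_iff)
      moreover have "sum_list (map sh (f # ds)) = p - l"
        using ds f by (simp add: algebra_simps)
      moreover have "\<exists>m. good z m \<and> Y0 w + snd (\<Lambda> l) \<le> Y0 z + snd (\<Lambda> m)"
        if z: "z \<in> set (awalk_verts w (f # ds))" for z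
      proof (cases "z = w")
        case True
        then show ?thesis
          using good by blast
      next
        case False
        then have "z \<in> set (awalk_verts v ds)"
          using z f by simp
        then obtain m where "good z m" "Y0 v + snd (\<Lambda> ?m) \<le> Y0 z + snd (\<Lambda> m)"
          using hgt by blast
        then show ?thesis
          using up by (intro exI[of _ m]) simp
      qed
      ultimately show ?thesis by blast
    qed
  qed
  \<comment> \<open>The climb starts at the head of \<open>e\<close>, which stays within one period
    by the same overlap argument.\<close>
  have "good ?v (sh e)"
  proof -
    have v: "?v \<in> verts H" and u: "?u \<in> verts H"
      using e by auto
    have "Y1 ?v + snd (\<Lambda> (sh e)) \<le> Y1 ?u + h"
    proof (rule ccontr)
      assume top: "\<not> ?thesis"
      have "?v = ?u \<and> sh e = p"
      proof (rule no_overlap[OF v u])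
        show "max (X0 ?v + fst (\<Lambda> (sh e))) (X0 ?u + fst (\<Lambda> p)) <
            min (X1 ?v + fst (\<Lambda> (sh e))) (X1 ?u + fst (\<Lambda> p))"
          using x H by auto
        show "max (Y0 ?v + snd (\<Lambda> (sh e))) (Y0 ?u + snd (\<Lambda> p)) <
            min (Y1 ?v + snd (\<Lambda> (sh e))) (Y1 ?u + snd (\<Lambda> p))"
          using top uv H Y_less[OF v] Y_less[OF u] by (auto simp: above_def)
      qed
      then show False
        using top H by auto
    qed
    then show ?thesis
      using uv x v by (auto simp: good_def above_def)
  qed
  from *[OF this] obtain ds where ds: "awalk ?v ds ?u" "distinct (awalk_verts ?v ds)"
      "sum_list (map sh ds) = p - sh e"
    by blast
  have "cycle (e # ds)"
    using ds e by (auto simp: cycle_def awalk_Cons_iff)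
  moreover have "sum_list (map sh (e # ds)) = p"
    using ds by simp
  ultimately show thesis
    by (intro that) auto
qed

end


section \<open>The homotopy class of a closed walk\<close>

text \<open>The sets are half-open integer intervals, at most one of each pair being nonempty. The
  two versions serve the two possible signs of \<open>cross d t\<close>.\<close>

lemma card_diff_int:
  fixes f :: "'a \<Rightarrow> int"
  shows "int (card {k. k < f x \<and> \<not> k < f y}) - int (card {k. \<not> k < f x \<and> k < f y}) = f x - f y"
    and "int (card {k. f x < k \<and> \<not> f y < k}) - int (card {k. \<not> f x < k \<and> f y < k}) = f y - f x"
proof -
  have "{k. k < f x \<and> \<not> k < f y} = {f y..<f x}" "{k. \<not> k < f x \<and> k < f y} = {f x..<f y}"
    "{k. f x < k \<and> \<not> f y < k} = {f x<..f y}" "{k. \<not> f x < k \<and> f y < k} = {f y<..f x}"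
    by auto
  then show "int (card {k. k < f x \<and> \<not> k < f y}) - int (card {k. \<not> k < f x \<and> k < f y}) = f x - f y"
    and "int (card {k. f x < k \<and> \<not> f y < k}) - int (card {k. \<not> f x < k \<and> f y < k}) = f y - f x"
    by auto
qed

text \<open>The quotient is the coefficient of \<open>z\<close> along \<open>t\<close> in the basis
  of \<open>d\<close> and \<open>t\<close>. The ceiling reflects that points on a line count as
  lying on its right.\<close>

lemma left_of_scaleR_pos:
  assumes "cross d t > 0"
  shows "left_of d (of_int k *\<^sub>R t) z \<longleftrightarrow> k < \<lceil>cross d z / cross d t\<rceil>"
proof -
  have "cross d (z - of_int k *\<^sub>R t) = cross d z - of_int k * cross d t"
    by (simp add: cross_def algebra_simps)
  then show ?thesis
    using assms by (simp add: left_of_def less_ceiling_iff pos_less_divide_eq)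
qed

text \<open>The negative sign reverses the inequality, and strictness now leads to the
  floor.\<close>

lemma left_of_scaleR_neg:
  assumes "cross d t < 0"
  shows "left_of d (of_int k *\<^sub>R t) z \<longleftrightarrow> \<lfloor>cross d z / cross d t\<rfloor> < k"
proof -
  have "cross d (z - of_int k *\<^sub>R t) = cross d z - of_int k * cross d t"
    by (simp add: cross_def algebra_simps)
  then show ?thesis
    using assms by (simp add: left_of_def floor_less_iff neg_divide_less_eq)
qed

text \<open>Each segment contributes a difference of ceilings, and these telescope, so only the end
  points of the polyline matter.\<close>

lemma crossings_pos:
  assumes "cross d t > 0" "P \<noteq> []"
  shows "crossings d t P = \<lceil>cross d (hd P) / cross d t\<rceil> - \<lceil>cross d (last P) / cross d t\<rceil>"
  using assms
proof (induction d t P rule: crossings.induct)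
  case (1 d t x y P)
  have "int (left_to_right d t x y) - int (right_to_left d t x y) =
      \<lceil>cross d x / cross d t\<rceil> - \<lceil>cross d y / cross d t\<rceil>"
    unfolding left_to_right_def right_to_left_def left_of_scaleR_pos[OF 1(2)]
    by (rule card_diff_int(1))
  then show ?case
    using 1 by simp
qed auto

lemma crossings_neg:
  assumes "cross d t < 0" "P \<noteq> []"
  shows "crossings d t P = \<lfloor>cross d (last P) / cross d t\<rfloor> - \<lfloor>cross d (hd P) / cross d t\<rfloor>"
  using assms
proof (induction d t P rule: crossings.induct)
  case (1 d t x y P)
  have "int (left_to_right d t x y) - int (right_to_left d t x y) =
      \<lfloor>cross d y / cross d t\<rfloor> - \<lfloor>cross d x / cross d t\<rfloor>"
    unfolding left_to_right_def right_to_left_def left_of_scaleR_neg[OF 1(2)]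
    by (rule card_diff_int(2))
  then show ?case
    using 1 by simp
qed auto

section \<open>Shifts and cell indices\<close>

context
  fixes Q :: flat_torus and G :: "('v, 'e) pre_digraph" and D :: "('v, 'e) drawing"
  assumes Q: "is_flat_torus Q" and emb: "embedded Q G D"
begin

text \<open>\<open>m_cell\<close> and \<open>h_cell\<close> round the coefficients of
  \<open>z\<close> along the horizon and the meridian. Floor and ceiling match
  \<open>crossings_neg\<close> and \<open>crossings_pos\<close>.\<close>

definition m_cell :: "plane \<Rightarrow> int" where
  "m_cell z = \<lfloor>cross (meridian Q) z / cross (meridian Q) (horizon Q)\<rfloor>"

definition h_cell :: "plane \<Rightarrow> int" where
  "h_cell z = \<lceil>cross (horizon Q) z / cross (horizon Q) (meridian Q)\<rceil>"

lemma cross_meridian_horizon: "cross (meridian Q) (horizon Q) < 0"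
  using Q by (simp add: is_flat_torus_def cross_def mult.commute)

lemma m_cell_lat: "m_cell (lat Q k + z) = fst k + m_cell z"
proof -
  have "cross (meridian Q) (lat Q k + z) =
      of_int (fst k) * cross (meridian Q) (horizon Q) + cross (meridian Q) z"
    by (simp add: cross_def lat_def algebra_simps)
  then show ?thesis
    using cross_meridian_horizon by (simp add: m_cell_def add_divide_distrib)
qed

lemma h_cell_lat: "h_cell (lat Q k + z) = snd k + h_cell z"
proof -
  have "cross (horizon Q) (lat Q k + z) =
      of_int (snd k) * cross (horizon Q) (meridian Q) + cross (horizon Q) z"
    by (simp add: cross_def lat_def algebra_simps)
  moreover have "cross (horizon Q) (meridian Q) > 0"
    using Q by (simp add: is_flat_torus_def)
  ultimately show ?thesis
    by (simp add: h_cell_def add_divide_distrib) (metis add.commute ceiling_add_of_int)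
qed

text \<open>Only the end points of a route count, so a dart contributes its shift plus a difference
  of cell indices at its ends. A reversed route starts at the translated head, whence the negated
  shift.\<close>

lemma crossings_droute:
  assumes d: "d \<in> darts G"
  shows "crossings (meridian Q) (horizon Q) (droute D d) =
      fst (dshift D d) + m_cell (pt D (dhead G d)) - m_cell (pt D (dtail G d))"
    and "- crossings (horizon Q) (meridian Q) (droute D d) =
      snd (dshift D d) + h_cell (pt D (dhead G d)) - h_cell (pt D (dtail G d))"
proof -
  obtain e b where eb: "d = (e, b)" "e \<in> arcs G"
    using d by (auto simp: darts_def)
  have r: "length (route D e) \<ge> 2" "hd (route D e) = pt D (tail G e)"
      "last (route D e) = lat Q (shift D e) + pt D (head G e)"
    using emb eb by (auto simp: embedded_def)
  then have ne: "route D e \<noteq> []" "droute D d \<noteq> []"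
    by (auto simp: droute_def eb)
  have pos: "cross (horizon Q) (meridian Q) > 0"
    using Q by (simp add: is_flat_torus_def)
  show "crossings (meridian Q) (horizon Q) (droute D d) =
      fst (dshift D d) + m_cell (pt D (dhead G d)) - m_cell (pt D (dtail G d))"
    unfolding crossings_neg[OF cross_meridian_horizon ne(2)]
    by (simp flip: m_cell_def add: droute_def eb dshift_def dhead_def dtail_def r ne
        hd_rev last_rev m_cell_lat)
  show "- crossings (horizon Q) (meridian Q) (droute D d) =
      snd (dshift D d) + h_cell (pt D (dhead G d)) - h_cell (pt D (dtail G d))"
    unfolding crossings_pos[OF pos ne(2)]
    by (simp flip: h_cell_def add: droute_def eb dshift_def dhead_def dtail_def r ne
        hd_rev last_rev h_cell_lat)
qed

text \<open>Stated for open walks so that the induction goes through; on a closed walk the cell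
  differences vanish and the sum of the shifts remains.\<close>

lemma homotopy_class_walk:
  assumes "pre_digraph.cas (dart_digraph G L) u ds v" "set ds \<subseteq> darts G"
  shows "homotopy_class Q (walk_curve D ds) = sum_list (map (dshift D) ds) +
      (m_cell (pt D v) - m_cell (pt D u), h_cell (pt D v) - h_cell (pt D u))"
  using assms
proof (induction ds arbitrary: u)
  case Nil
  then show ?case
    by (simp add: pre_digraph.cas.simps homotopy_class_def m_class_def h_class_def walk_curve_def
        zero_prod_def)
next
  case (Cons d ds)
  have u: "u = dtail G d" and "pre_digraph.cas (dart_digraph G L) (dhead G d) ds v"
    using Cons.prems by (auto simp: pre_digraph.cas.simps dart_digraph_def)
  with Cons have "homotopy_class Q (walk_curve D ds) = sum_list (map (dshift D) ds) +
      (m_cell (pt D v) - m_cell (pt D (dhead G d)), h_cell (pt D v) - h_cell (pt D (dhead G d)))"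
    by simp
  then show ?case
    using crossings_droute[of d] Cons.prems(2)
    by (auto simp: homotopy_class_def m_class_def h_class_def walk_curve_def prod_eq_iff u)
qed

lemma homotopy_class_cycle:
  assumes "directed_cycle G L c" "L \<subseteq> darts G"
  shows "homotopy_class Q (walk_curve D c) = sum_list (map (dshift D) c)"
  using assms homotopy_class_walk[of L _ c]
  by (fastforce simp: directed_cycle_def pre_digraph.cycle_def pre_digraph.awalk_def
      dart_digraph_def zero_prod_def[symmetric])

end


section \<open>Rectangular duals as tilings\<close>

lemma lat_add: "lat Q (j + k) = lat Q j + lat Q k"
  by (simp add: lat_def algebra_simps)

text \<open>By Cramer's rule, the coefficients of a lattice vector are, up to sign, its cross
  products with the side vectors divided by the cross product of these, hence bounded by
  \<open>C\<close>.\<close>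

lemma finite_lat_in_box:
  assumes "is_flat_torus Q"
  shows "finite {k. \<bar>fst (lat Q k)\<bar> \<le> B \<and> \<bar>snd (lat Q k)\<bar> \<le> B}" (is "finite ?K")
proof -
  let ?M = "meridian Q" and ?H = "horizon Q"
  define C where "C = B * (\<bar>fst ?M\<bar> + \<bar>snd ?M\<bar> + \<bar>fst ?H\<bar> + \<bar>snd ?H\<bar>) / cross ?H ?M"
  have pos: "cross ?H ?M > 0"
    using assms by (simp add: is_flat_torus_def)
  have "?K \<subseteq> {- \<lceil>C\<rceil>..\<lceil>C\<rceil>} \<times> {- \<lceil>C\<rceil>..\<lceil>C\<rceil>}"
  proof
    fix k assume k: "k \<in> ?K"
    have B: "B \<ge> 0"
      using k by auto
    have bound: "\<bar>fst a * snd b - snd a * fst b\<bar> \<le> B * (\<bar>fst b\<bar> + \<bar>snd b\<bar>)"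
      if "\<bar>fst a\<bar> \<le> B" "\<bar>snd a\<bar> \<le> B" for a b :: plane
    proof -
      have "\<bar>fst a * snd b - snd a * fst b\<bar> \<le> \<bar>fst a\<bar> * \<bar>snd b\<bar> + \<bar>snd a\<bar> * \<bar>fst b\<bar>"
        using abs_triangle_ineq4[of "fst a * snd b" "snd a * fst b"] by (simp add: abs_mult)
      also have "\<dots> \<le> B * \<bar>snd b\<bar> + B * \<bar>fst b\<bar>"
        using that by (intro add_mono mult_right_mono) auto
      finally show ?thesis
        by (simp add: algebra_simps)
    qed
    have "of_int (fst k) * cross ?H ?M = cross (lat Q k) ?M"
      "of_int (snd k) * cross ?H ?M = - cross (lat Q k) ?H"
      by (simp_all add: cross_def lat_def algebra_simps)
    then have "\<bar>of_int (fst k)\<bar> * cross ?H ?M = \<bar>cross (lat Q k) ?M\<bar>"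
      "\<bar>of_int (snd k)\<bar> * cross ?H ?M = \<bar>cross (lat Q k) ?H\<bar>"
      using pos by (metis abs_mult abs_of_pos, metis abs_minus_cancel abs_mult abs_of_pos)
    moreover have "\<bar>cross (lat Q k) ?M\<bar> \<le> C * cross ?H ?M" "\<bar>cross (lat Q k) ?H\<bar> \<le> C * cross ?H ?M"
      using bound[of "lat Q k" ?M] bound[of "lat Q k" ?H] k B pos
      by (auto simp: C_def cross_def distrib_left intro: order_trans)
    ultimately have "\<bar>of_int (fst k)\<bar> * cross ?H ?M \<le> C * cross ?H ?M"
      "\<bar>of_int (snd k)\<bar> * cross ?H ?M \<le> C * cross ?H ?M"
      by simp_all
    then have "\<bar>of_int (fst k)\<bar> \<le> C" "\<bar>of_int (snd k)\<bar> \<le> C"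
      using pos by (simp_all only: mult_le_cancel_right_pos)
    then have "\<bar>fst k\<bar> \<le> \<lceil>C\<rceil>" "\<bar>snd k\<bar> \<le> \<lceil>C\<rceil>"
      by linarith+
    then show "k \<in> {- \<lceil>C\<rceil>..\<lceil>C\<rceil>} \<times> {- \<lceil>C\<rceil>..\<lceil>C\<rceil>}"
      by (cases k) auto
  qed
  then show ?thesis
    by (rule finite_subset) auto
qed

section \<open>Contacts of rectangles in coordinates\<close>

lemma translate_rectangle:
  "translate Q k ({a..b} \<times> {c..d}) =
    {a + fst (lat Q k)..b + fst (lat Q k)} \<times> {c + snd (lat Q k)..d + snd (lat Q k)}"
proof (intro equalityI subsetI)
  fix z assume "z \<in> {a + fst (lat Q k)..b + fst (lat Q k)} \<times> {c + snd (lat Q k)..d + snd (lat Q k)}"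
  then have "z - lat Q k \<in> {a..b} \<times> {c..d}"
    by (auto simp: mem_Times_iff)
  then show "z \<in> translate Q k ({a..b} \<times> {c..d})"
    unfolding translate_def by (intro image_eqI[of _ _ "z - lat Q k"]) auto
qed (auto simp: translate_def mem_Times_iff)

text \<open>Yields the inequalities that define \<open>above\<close>. The height \<open>e\<close> of
  the contact separates the rectangles and occurs in both, so both facing sides lie at this
  height.\<close>

lemma below_rectangles_iff:
  assumes "a < b" "c < d" "a' < b'" "c' < d'"
  shows "below ({a..b} \<times> {c..d}) ({a'..b'} \<times> {c'..d'}) \<longleftrightarrow> c' = d \<and> max a a' < min b b'"
    (is "below ?A ?B \<longleftrightarrow> ?rhs")
proof
  assume "below ?A ?B"
  then obtain p q e where pq: "p < q" "?A \<inter> ?B = {p..q} \<times> {e}"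
      and A: "\<forall>z\<in>?A. snd z \<le> e" and B: "\<forall>z\<in>?B. e \<le> snd z"
    unfolding below_def by blast
  have "(p, e) \<in> ?A \<inter> ?B" "(q, e) \<in> ?A \<inter> ?B"
    unfolding pq(2) using pq(1) by auto
  moreover have "d \<le> e" "e \<le> c'"
    using bspec[OF A, of "(a, d)"] bspec[OF B, of "(a', c')"] assms by auto
  ultimately show ?rhs
    using pq(1) by auto
next
  assume ?rhs
  then have "?A \<inter> ?B = {max a a'..min b b'} \<times> {d}"
    using assms by auto
  then show "below ?A ?B"
    using \<open>?rhs\<close> unfolding below_def by (intro exI conjI) auto
qed

lemma left_neighbour_rectangles_iff:
  assumes "a < b" "c < d" "a' < b'" "c' < d'"
  shows "left_neighbour ({a..b} \<times> {c..d}) ({a'..b'} \<times> {c'..d'}) \<longleftrightarrow> a' = b \<and> max c c' < min d d'"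
    (is "left_neighbour ?A ?B \<longleftrightarrow> ?rhs")
proof
  assume "left_neighbour ?A ?B"
  then obtain p q e where pq: "p < q" "?A \<inter> ?B = {e} \<times> {p..q}"
      and A: "\<forall>z\<in>?A. fst z \<le> e" and B: "\<forall>z\<in>?B. e \<le> fst z"
    unfolding left_neighbour_def by blast
  have "(e, p) \<in> ?A \<inter> ?B" "(e, q) \<in> ?A \<inter> ?B"
    unfolding pq(2) using pq(1) by auto
  moreover have "b \<le> e" "e \<le> a'"
    using bspec[OF A, of "(b, c)"] bspec[OF B, of "(a', c')"] assms by auto
  ultimately show ?rhs
    using pq(1) by auto
next
  assume ?rhs
  then have "?A \<inter> ?B = {b} \<times> {max c c'..min d d'}"
    using assms by auto
  then show "left_neighbour ?A ?B"
    using \<open>?rhs\<close> unfolding left_neighbour_def by (intro exI conjI) auto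
qed

lemma below_imp_contact: "below A B \<Longrightarrow> contact A B"
proof -
  assume "below A B"
  then obtain p q e :: real where pq: "p < q" "A \<inter> B = {p..q} \<times> {e}"
    unfolding below_def by blast
  then have "A \<inter> B = closed_segment (p, e) (q, e)"
    by (simp add: closed_segment_same_snd closed_segment_eq_real_ivl)
  moreover have "(p, e) \<noteq> (q, e)"
    using pq(1) by simp
  ultimately show "contact A B"
    unfolding contact_def by (intro exI conjI)
qed

lemma left_neighbour_imp_contact: "left_neighbour A B \<Longrightarrow> contact A B"
proof -
  assume "left_neighbour A B"
  then obtain p q e :: real where pq: "p < q" "A \<inter> B = {e} \<times> {p..q}"
    unfolding left_neighbour_def by blast
  then have "A \<inter> B = closed_segment (e, p) (e, q)"
    by (simp add: closed_segment_same_fst closed_segment_eq_real_ivl)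
  moreover have "(e, p) \<noteq> (e, q)"
    using pq(1) by simp
  ultimately show "contact A B"
    unfolding contact_def by (intro exI conjI)
qed

section \<open>From rectangular duals to tilings and their digraphs\<close>

lemma tiling_swap:
  assumes "tiling V X0 X1 Y0 Y1 \<Lambda>"
  shows "tiling V Y0 Y1 X0 X1 (prod.swap \<circ> \<Lambda>)"
proof -
  interpret tiling V X0 X1 Y0 Y1 \<Lambda> by fact
  show ?thesis
  proof
    show "finite {k. \<bar>fst ((prod.swap \<circ> \<Lambda>) k)\<bar> \<le> B \<and> \<bar>snd ((prod.swap \<circ> \<Lambda>) k)\<bar> \<le> B}" for B
      by (rule finite_subset[OF _ locally_finite[of B]]) auto
    show "\<exists>v\<in>V. \<exists>k. Y0 v + fst ((prod.swap \<circ> \<Lambda>) k) \<le> x \<and> x \<le> Y1 v + fst ((prod.swap \<circ> \<Lambda>) k) \<and>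
        X0 v + snd ((prod.swap \<circ> \<Lambda>) k) \<le> y \<and> y \<le> X1 v + snd ((prod.swap \<circ> \<Lambda>) k)" for x y
      using cover[of y x] by auto
    show "u = v \<and> k = 0" if "u \<in> V" "v \<in> V"
      "max (Y0 u) (Y0 v + fst ((prod.swap \<circ> \<Lambda>) k)) < min (Y1 u) (Y1 v + fst ((prod.swap \<circ> \<Lambda>) k))"
      "max (X0 u) (X0 v + snd ((prod.swap \<circ> \<Lambda>) k)) < min (X1 u) (X1 v + snd ((prod.swap \<circ> \<Lambda>) k))"
      for u v k
      using no_overlap_0[of u v k] that by simp
  qed (use finite_V X_less Y_less shift_add in \<open>auto simp: prod_eq_iff\<close>)
qed

lemma tiling_rectangular_dual:
  assumes Q: "is_flat_torus Q" and fin: "finite (verts G)" and dual: "rectangular_dual Q G D R"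
  obtains X0 X1 Y0 Y1 where "tiling (verts G) X0 X1 Y0 Y1 (lat Q)"
    "\<And>v. v \<in> verts G \<Longrightarrow> R v = {X0 v..X1 v} \<times> {Y0 v..Y1 v}"
proof -
  have "\<forall>v\<in>verts G. \<exists>a b c d. a < b \<and> c < d \<and> R v = {a..b} \<times> {c..d}"
    using dual by (simp add: rectangular_dual_def axis_rectangle_def)
  then obtain X0 X1 Y0 Y1 where R: "\<And>v. v \<in> verts G \<Longrightarrow>
      X0 v < X1 v \<and> Y0 v < Y1 v \<and> R v = {X0 v..X1 v} \<times> {Y0 v..Y1 v}"
    by metis
  have "tiling (verts G) X0 X1 Y0 Y1 (lat Q)"
  proof
    fix u v k
    assume u: "u \<in> verts G" and v: "v \<in> verts G"
      and X: "max (X0 u) (X0 v + fst (lat Q k)) < min (X1 u) (X1 v + fst (lat Q k))"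
      and Y: "max (Y0 u) (Y0 v + snd (lat Q k)) < min (Y1 u) (Y1 v + snd (lat Q k))"
    \<comment> \<open>Intervals overlapping in both coordinates yield a common inner point of the
      two rectangles.\<close>
    obtain x y where "max (X0 u) (X0 v + fst (lat Q k)) < x" "x < min (X1 u) (X1 v + fst (lat Q k))"
      "max (Y0 u) (Y0 v + snd (lat Q k)) < y" "y < min (Y1 u) (Y1 v + snd (lat Q k))"
      using dense[OF X] dense[OF Y] by blast
    then have "(x, y) \<in> interior (R u) \<inter> interior (translate Q k (R v))"
      using R[OF u] R[OF v] by (simp add: translate_rectangle interior_Times)
    then have "\<not> (u, 0) \<noteq> (v, k)"
      using dual u v unfolding rectangular_dual_def by blast
    then show "u = v \<and> k = 0"
      by auto
  next
    fix x y
    have "(x, y) \<in> (\<Union>v\<in>verts G. \<Union>k. translate Q k (R v))"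
      using dual by (simp add: rectangular_dual_def)
    then obtain v k where "v \<in> verts G" "(x, y) \<in> translate Q k (R v)"
      by blast
    then show "\<exists>v\<in>verts G. \<exists>k. X0 v + fst (lat Q k) \<le> x \<and> x \<le> X1 v + fst (lat Q k) \<and>
        Y0 v + snd (lat Q k) \<le> y \<and> y \<le> Y1 v + snd (lat Q k)"
      using R[of v] by (intro bexI[of _ v] exI[of _ k]) (auto simp: translate_rectangle)
  qed (use fin R lat_add finite_lat_in_box[OF Q] in auto)
  then show thesis
    using R that by blast
qed

lemma wf_dart_digraph:
  assumes "wf_digraph G" "L \<subseteq> darts G"
  shows "wf_digraph (dart_digraph G L)"
  using assms unfolding wf_digraph_def
  by (auto simp: dart_digraph_def darts_def dtail_def dhead_def)

text \<open>Arcs are contacts by the definition of \<open>REL_of\<close>. Conversely, a contact has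
  a dart with the same ends and lattice vector, which therefore gets the colour and direction of
  that contact.\<close>

lemma tiling_digraph_REL_of:
  assumes G: "wf_digraph G" and dual: "rectangular_dual Q G D R"
    and til: "tiling (verts G) X0 X1 Y0 Y1 (lat Q)"
    and R: "\<And>v. v \<in> verts G \<Longrightarrow> R v = {X0 v..X1 v} \<times> {Y0 v..Y1 v}"
  shows "tiling_digraph (dart_digraph G (fst (REL_of Q G D R))) X0 X1 Y0 Y1 (lat Q) (dshift D)"
    and "tiling_digraph (dart_digraph G (snd (REL_of Q G D R))) Y0 Y1 X0 X1
      (prod.swap \<circ> lat Q) (dshift D)"
proof -
  interpret G: wf_digraph G by fact
  interpret tiling "verts G" X0 X1 Y0 Y1 "lat Q" by fact
  interpret swap: tiling "verts G" Y0 Y1 X0 X1 "prod.swap \<circ> lat Q"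
    by (rule tiling_swap[OF til])
  have below: "below (R u) (translate Q k (R v)) \<longleftrightarrow> above u v k"
    and left: "left_neighbour (R u) (translate Q k (R v)) \<longleftrightarrow> swap.above u v k"
    if "u \<in> verts G" "v \<in> verts G" for u v k
    using X_less[OF that(1)] X_less[OF that(2)] Y_less[OF that(1)] Y_less[OF that(2)]
    by (simp_all add: R that translate_rectangle below_rectangles_iff left_neighbour_rectangles_iff
        above_def swap.above_def)
  have ends: "dtail G d \<in> verts G" "dhead G d \<in> verts G" if "d \<in> darts G" for d
    using that by (auto simp: darts_def dtail_def dhead_def)
  have dart: "\<exists>d\<in>darts G. dtail G d = u \<and> dhead G d = v \<and> dshift D d = k"
    if "u \<in> verts G" "v \<in> verts G" "contact (R u) (translate Q k (R v))" for u v k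
    using dual that unfolding rectangular_dual_def by blast
  show "tiling_digraph (dart_digraph G (fst (REL_of Q G D R))) X0 X1 Y0 Y1 (lat Q) (dshift D)"
  proof (intro tiling_digraph.intro tiling_digraph_axioms.intro)
    show "wf_digraph (dart_digraph G (fst (REL_of Q G D R)))"
      by (rule wf_dart_digraph[OF G]) (auto simp: REL_of_def)
    show "tiling (verts (dart_digraph G (fst (REL_of Q G D R)))) X0 X1 Y0 Y1 (lat Q)"
      using til by (simp add: dart_digraph_def)
  next
    fix d assume "d \<in> arcs (dart_digraph G (fst (REL_of Q G D R)))"
    then show "tiling.above X0 X1 Y0 Y1 (lat Q) (tail (dart_digraph G (fst (REL_of Q G D R))) d)
        (head (dart_digraph G (fst (REL_of Q G D R))) d) (dshift D d)"
      using below[of "dtail G d" "dhead G d" "dshift D d"] ends[of d]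
      by (simp add: dart_digraph_def REL_of_def)
  next
    fix u v k assume "u \<in> verts (dart_digraph G (fst (REL_of Q G D R)))"
      "v \<in> verts (dart_digraph G (fst (REL_of Q G D R)))"
      and up: "tiling.above X0 X1 Y0 Y1 (lat Q) u v k"
    then have uv: "u \<in> verts G" "v \<in> verts G"
      by (auto simp: dart_digraph_def)
    then show "\<exists>e\<in>arcs (dart_digraph G (fst (REL_of Q G D R))).
        tail (dart_digraph G (fst (REL_of Q G D R))) e = u \<and>
        head (dart_digraph G (fst (REL_of Q G D R))) e = v \<and> dshift D e = k"
      using dart[OF uv below_imp_contact] below[OF uv] up
      by (fastforce simp: dart_digraph_def REL_of_def)
  qed
  show "tiling_digraph (dart_digraph G (snd (REL_of Q G D R))) Y0 Y1 X0 X1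
      (prod.swap \<circ> lat Q) (dshift D)"
  proof (intro tiling_digraph.intro tiling_digraph_axioms.intro)
    show "wf_digraph (dart_digraph G (snd (REL_of Q G D R)))"
      by (rule wf_dart_digraph[OF G]) (auto simp: REL_of_def)
    show "tiling (verts (dart_digraph G (snd (REL_of Q G D R)))) Y0 Y1 X0 X1 (prod.swap \<circ> lat Q)"
      using swap.tiling_axioms by (simp add: dart_digraph_def)
  next
    fix d assume "d \<in> arcs (dart_digraph G (snd (REL_of Q G D R)))"
    then show "tiling.above Y0 Y1 X0 X1 (prod.swap \<circ> lat Q)
        (tail (dart_digraph G (snd (REL_of Q G D R))) d)
        (head (dart_digraph G (snd (REL_of Q G D R))) d) (dshift D d)"
      using left[of "dtail G d" "dhead G d" "dshift D d"] ends[of d]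
      by (simp add: dart_digraph_def REL_of_def)
  next
    fix u v k assume "u \<in> verts (dart_digraph G (snd (REL_of Q G D R)))"
      "v \<in> verts (dart_digraph G (snd (REL_of Q G D R)))"
      and up: "tiling.above Y0 Y1 X0 X1 (prod.swap \<circ> lat Q) u v k"
    then have uv: "u \<in> verts G" "v \<in> verts G"
      by (auto simp: dart_digraph_def)
    then show "\<exists>e\<in>arcs (dart_digraph G (snd (REL_of Q G D R))).
        tail (dart_digraph G (snd (REL_of Q G D R))) e = u \<and>
        head (dart_digraph G (snd (REL_of Q G D R))) e = v \<and> dshift D e = k"
      using dart[OF uv left_neighbour_imp_contact] left[OF uv] up
      by (fastforce simp: dart_digraph_def REL_of_def)
  qed
qed

section \<open>The labeling of a rectangular dual\<close>

theorem lemma2: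
  fixes Q :: flat_torus
    and G :: "('v, 'e) pre_digraph"
    and D :: "('v, 'e) drawing"
    and R :: "'v \<Rightarrow> plane set"
    and \<L> :: "'e REL"
  assumes "is_flat_torus Q"
    and "PTT Q G D"
    and "rectangular_dual Q G D R"
    and "\<L> = REL_of Q G D R"
  shows "realizable G \<L> \<and> (axis_aligned Q \<longrightarrow> orbital Q G D \<L>)"
proof -
  have fin: "fin_digraph G" and emb: "embedded Q G D"
    using assms(2) by (auto simp: PTT_def)
  have G: "wf_digraph G" "finite (verts G)"
    using fin by (auto simp: fin_digraph_def fin_digraph_axioms_def)
  obtain X0 X1 Y0 Y1 where til: "tiling (verts G) X0 X1 Y0 Y1 (lat Q)"
      and R: "\<And>v. v \<in> verts G \<Longrightarrow> R v = {X0 v..X1 v} \<times> {Y0 v..Y1 v}"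
    using tiling_rectangular_dual[OF assms(1) G(2) assms(3)] by blast
  interpret blue: tiling_digraph "dart_digraph G (fst \<L>)" X0 X1 Y0 Y1 "lat Q" "dshift D"
    unfolding assms(4) by (rule tiling_digraph_REL_of(1)[OF G(1) assms(3) til R])
  interpret red: tiling_digraph "dart_digraph G (snd \<L>)" Y0 Y1 X0 X1 "prod.swap \<circ> lat Q" "dshift D"
    unfolding assms(4) by (rule tiling_digraph_REL_of(2)[OF G(1) assms(3) til R])
  have arcs: "arcs (dart_digraph G L) = L" for L
    by (simp add: dart_digraph_def)
  have "realizable G \<L>"
    unfolding realizable_def directed_cycle_def
    using blue.arc_in_cycle red.arc_in_cycle unfolding arcs by metis
  moreover have "orbital Q G D \<L>" if ax: "axis_aligned Q"
  proof -
    define W h where "W = fst (horizon Q)" and "h = snd (meridian Q)"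
    have pos: "W > 0" "h > 0"
      using assms(1) by (auto simp: is_flat_torus_def W_def h_def)
    \<comment> \<open>Axis alignment makes the lattice a product of two one-dimensional ones, as
      \<open>arc_in_orbital_cycle\<close> requires.\<close>
    have lat: "lat Q k = (of_int (fst k) * W, of_int (snd k) * h)" for k
      using ax by (simp add: lat_def axis_aligned_def W_def h_def prod_eq_iff)
    have sub: "fst \<L> \<subseteq> darts G" "snd \<L> \<subseteq> darts G"
      by (auto simp: assms(4) REL_of_def)
    have "\<exists>c. directed_cycle G (fst \<L>) c \<and> d \<in> set c \<and>
        parallel Q (walk_curve D c) (first_orbit Q)" if "d \<in> fst \<L>" for d
    proof -
      have "d \<in> arcs (dart_digraph G (fst \<L>))" "lat Q (1, 0) = (W, 0)" "lat Q (0, 1) = (0, h)"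
          "\<exists>i j. lat Q k = (of_int i * W, of_int j * h)" for k
        using that lat[of k] by (auto simp: lat arcs)
      note blue.arc_in_orbital_cycle[OF this(1) pos(1) this(2) pos(2) this(3,4)]
      then obtain c where c: "directed_cycle G (fst \<L>) c" "d \<in> set c"
          "sum_list (map (dshift D) c) = (0, 1)"
        unfolding directed_cycle_def by blast
      then show ?thesis
        using homotopy_class_cycle[OF assms(1) emb c(1) sub(1)] homotopy_class_meridian[OF assms(1)]
        by (auto simp: parallel_def)
    qed
    moreover have "\<exists>c. directed_cycle G (snd \<L>) c \<and> d \<in> set c \<and>
        parallel Q (walk_curve D c) (second_orbit Q)" if "d \<in> snd \<L>" for d
    proof -
      \<comment> \<open>In exchanged coordinates the period along the line is the horizon, so the
        shifts sum to \<open>(1, 0)\<close>.\<close>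
      have "d \<in> arcs (dart_digraph G (snd \<L>))" "(prod.swap \<circ> lat Q) (0, 1) = (h, 0)"
          "(prod.swap \<circ> lat Q) (1, 0) = (0, W)"
          "\<exists>i j. (prod.swap \<circ> lat Q) k = (of_int i * h, of_int j * W)" for k
        using that lat[of k] by (auto simp: lat arcs)
      note red.arc_in_orbital_cycle[OF this(1) pos(2) this(2) pos(1) this(3,4)]
      then obtain c where c: "directed_cycle G (snd \<L>) c" "d \<in> set c"
          "sum_list (map (dshift D) c) = (1, 0)"
        unfolding directed_cycle_def by blast
      then show ?thesis
        using homotopy_class_cycle[OF assms(1) emb c(1) sub(2)] homotopy_class_horizon[OF assms(1)]
        by (auto simp: parallel_def)
    qed
    ultimately show ?thesis
      unfolding orbital_def by blast
  qed
  ultimately show ?thesis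
    by blast
qed

end
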